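(* Let $E$ be a convenient vector space, $U \subseteq E$ a $c^\infty$-open subset, and $0 < \alpha \le 1$. Let $u \mapsto A(u)$, for $u \in U$, be a $C^{0,\alpha}$-mapping whose values are unbounded self-adjoint operators in a Hilbert space $H$ with common domain of definition and with compact resolvent. Let $\lambda : U \to \mathbb{R}$ be a continuous function (with respect to the $c^\infty$-topology on $U$) such that $\lambda(u)$ is an eigenvalue of $A(u)$ for every $u \in U$. Then $\lambda$ is $C^{0,\alpha}$ on $U$.
   Context: A convenient vector space is a (Hausdorff) locally convex vector space $E$ satisfying the following equivalent conditions: every Mackey Cauchy sequence converges; $C^\infty$-curves in $E$ are locally integrable in $E$; a curve $c:\mathbb{R}\to E$ is $C^\infty$ if and only if $\ell\circ c$ is $C^\infty$ for all continuous linear functionals $\ell$ on $E$. Smooth means $C^\infty$. The $c^\infty$-topology on $E$ is the final topology with respect to all smooth curves $c:\mathbb{R}\to E$; $c^\infty$-open means open in this topology. A scalar-valued function $f$ on $\mathbb{R}$ is called $C^{0,\alpha}$ if $\frac{f(t)-f(s)}{|t-s|^\alpha}$ is locally bounded in $t\neq s$ (for $\alpha=1$ this is locally Lipschitz). A scalar-valued function $f$ on a $c^\infty$-open subset $U$ of a convenient vector space is called $C^{0,\alpha}$ if $f\circ c$ is $C^{0,\alpha}$ for every smooth curve $c:\mathbb{R}\to U$. A mapping $u\mapsto A(u)$ defined on a $c^\infty$-open subset $U$ of a convenient vector space is $C^{0,\alpha}$ with values in unbounded self-adjoint operators in $H$ with common domain of definition if: there is a dense subspace $V$ of $H$ such that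 $V$ is the domain of definition of each $A(u)$; $A(u)^*=A(u)$ for each $u\in U$; and $u\mapsto \langle A(u)v,w\rangle$ is $C^{0,\alpha}$ on $U$ for each $v\in V$ and $w\in H$. *)

theory Defs
  imports "HOL-Analysis.Analysis"
begin

class locally_convex_space = real_vector + t2_space + topological_ab_group_add +
  assumes tendsto_scaleR_Pair:
    "((\<lambda>p. scaleR (fst p) (snd p)) \<longlongrightarrow> scaleR r x) (nhds r \<times>\<^sub>F nhds x)"
  and locally_convex:
    "open W \<Longrightarrow> 0 \<in> W \<Longrightarrow> \<exists>C. open C \<and> 0 \<in> C \<and> C \<subseteq> W \<and>
      (\<forall>x\<in>C. \<forall>y\<in>C. \<forall>u\<ge>0. \<forall>v\<ge>0. u + v = 1 \<longrightarrow> scaleR u x + scaleR v y \<in> C)"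

text \<open>The constant \<^const>\<open>convex\<close> is not available inside the class specification.\<close>

lemma locally_convex':
  fixes W :: "'e::locally_convex_space set"
  assumes "open W" "0 \<in> W"
  shows "\<exists>C. open C \<and> convex C \<and> 0 \<in> C \<and> C \<subseteq> W"
  using locally_convex[OF assms] unfolding convex_def by blast

text \<open>The library's \<^const>\<open>bounded\<close> is metric; this is boundedness in the sense of
  topological vector spaces.\<close>

definition (in locally_convex_space) tvs_bounded :: "'a set \<Rightarrow> bool" where
  "tvs_bounded B \<longleftrightarrow> (\<forall>W. open W \<and> 0 \<in> W \<longrightarrow> (\<exists>r>0. B \<subseteq> (\<lambda>x. r *\<^sub>R x) ` W))"

definition (in locally_convex_space) Mackey_Cauchy :: "(nat \<Rightarrow> 'a) \<Rightarrow> bool" where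
  "Mackey_Cauchy X \<longleftrightarrow>
    (\<exists>B \<tau>. tvs_bounded B \<and>
      (\<tau> \<longlongrightarrow> (0::real)) (sequentially \<times>\<^sub>F sequentially) \<and>
      (\<forall>m n. X m - X n \<in> (\<lambda>x. \<tau> (m, n) *\<^sub>R x) ` B))"

class convenient_vector_space = locally_convex_space +
  assumes Mackey_complete: "Mackey_Cauchy X \<Longrightarrow> convergent X"

definition smooth_curve :: "(real \<Rightarrow> 'e::locally_convex_space) \<Rightarrow> bool" where
  "smooth_curve c \<longleftrightarrow>
    (\<exists>D. D 0 = c \<and>
      (\<forall>n t. ((\<lambda>h. (D n (t + h) - D n t) /\<^sub>R h) \<longlongrightarrow> D (Suc n) t) (at 0)))"

definition cinf_topology :: "'e::locally_convex_space topology" where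
  "cinf_topology = topology (\<lambda>W. \<forall>c. smooth_curve c \<longrightarrow> open (c -` W))"

lemma openin_cinf_topology:
  "openin cinf_topology W \<longleftrightarrow> (\<forall>c. smooth_curve c \<longrightarrow> open (c -` W))"
proof -
  have "istopology (\<lambda>W::'a set. \<forall>c. smooth_curve c \<longrightarrow> open (c -` W))"
    unfolding istopology_def by (auto simp: vimage_Int vimage_Union)
  then show ?thesis
    by (simp add: cinf_topology_def)
qed

text \<open>Local boundedness of the difference quotient is required near every point of the plane,
  including the points of the diagonal.\<close>

definition C0alpha :: "real \<Rightarrow> (real \<Rightarrow> 'k::real_normed_field) \<Rightarrow> bool" where
  "C0alpha \<alpha> f \<longleftrightarrow>
    (\<forall>p. \<exists>N. open N \<and> p \<in> N \<and>
      bounded ((\<lambda>(t, s). (f t - f s) /\<^sub>R (\<bar>t - s\<bar> powr \<alpha>)) ` {(t, s) \<in> N. t \<noteq> s}))"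

definition C0alpha_on ::
    "real \<Rightarrow> 'e::locally_convex_space set \<Rightarrow> ('e \<Rightarrow> 'k::real_normed_field) \<Rightarrow> bool" where
  "C0alpha_on \<alpha> U f \<longleftrightarrow>
    (\<forall>c. smooth_curve c \<and> range c \<subseteq> U \<longrightarrow> C0alpha \<alpha> (f \<circ> c))"

text \<open>The inner product is linear in the first argument.\<close>

class complex_hilbert_space = banach +
  fixes scaleC :: "complex \<Rightarrow> 'a \<Rightarrow> 'a" (infixr "*\<^sub>C" 75)
    and cinner :: "'a \<Rightarrow> 'a \<Rightarrow> complex"
  assumes scaleC_add_right: "a *\<^sub>C (x + y) = a *\<^sub>C x + a *\<^sub>C y"
    and scaleC_add_left: "(a + b) *\<^sub>C x = a *\<^sub>C x + b *\<^sub>C x"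
    and scaleC_scaleC: "a *\<^sub>C b *\<^sub>C x = (a * b) *\<^sub>C x"
    and scaleC_of_real: "of_real r *\<^sub>C x = r *\<^sub>R x"
    and cinner_commute: "cinner x y = cnj (cinner y x)"
    and cinner_add_left: "cinner (x + y) z = cinner x z + cinner y z"
    and cinner_scaleC_left: "cinner (a *\<^sub>C x) y = a * cinner x y"
    and cinner_self: "cinner x x = of_real ((norm x)\<^sup>2)"

global_interpretation complex_vector: vector_space "scaleC :: complex \<Rightarrow> 'a \<Rightarrow> 'a::complex_hilbert_space"
proof
  show "1 *\<^sub>C x = x" for x :: 'a
    using scaleC_of_real[of 1 x] by simp
qed (simp_all add: scaleC_add_right scaleC_add_left scaleC_scaleC)

text \<open>An unbounded operator is a partial map; its domain of definition is \<^term>\<open>dom T\<close>.\<close>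

definition linear_operator :: "('h::complex_hilbert_space \<rightharpoonup> 'h) \<Rightarrow> bool" where
  "linear_operator T \<longleftrightarrow>
    complex_vector.subspace (dom T) \<and>
    (\<forall>x\<in>dom T. \<forall>y\<in>dom T. the (T (x + y)) = the (T x) + the (T y)) \<and>
    (\<forall>a. \<forall>x\<in>dom T. the (T (a *\<^sub>C x)) = a *\<^sub>C the (T x))"

text \<open>The element \<open>z\<close> below is unique when the domain of \<open>T\<close> is dense.\<close>

definition adjoint_operator ::
    "('h::complex_hilbert_space \<rightharpoonup> 'h) \<Rightarrow> ('h \<rightharpoonup> 'h)" where
  "adjoint_operator T = (\<lambda>w.
    if \<exists>z. \<forall>v\<in>dom T. cinner (the (T v)) w = cinner v z
    then Some (THE z. \<forall>v\<in>dom T. cinner (the (T v)) w = cinner v z)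
    else None)"

definition self_adjoint :: "('h::complex_hilbert_space \<rightharpoonup> 'h) \<Rightarrow> bool" where
  "self_adjoint T \<longleftrightarrow>
    linear_operator T \<and> closure (dom T) = UNIV \<and> adjoint_operator T = T"

definition eigenvalue :: "('h::complex_hilbert_space \<rightharpoonup> 'h) \<Rightarrow> complex \<Rightarrow> bool" where
  "eigenvalue T z \<longleftrightarrow> (\<exists>v. v \<noteq> 0 \<and> T v = Some (z *\<^sub>C v))"

definition resolvent ::
    "('h::complex_hilbert_space \<rightharpoonup> 'h) \<Rightarrow> complex \<Rightarrow> 'h \<Rightarrow> 'h" where
  "resolvent T z = inv_into (dom T) (\<lambda>v. the (T v) - z *\<^sub>C v)"

definition resolvent_set :: "('h::complex_hilbert_space \<rightharpoonup> 'h) \<Rightarrow> complex set" where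
  "resolvent_set T =
    {z. bij_betw (\<lambda>v. the (T v) - z *\<^sub>C v) (dom T) UNIV \<and> bounded_linear (resolvent T z)}"

definition compact_operator :: "('h::complex_hilbert_space \<Rightarrow> 'h) \<Rightarrow> bool" where
  "compact_operator S \<longleftrightarrow>
    bounded_linear S \<and> (\<forall>B. bounded B \<longrightarrow> compact (closure (S ` B)))"

definition compact_resolvent :: "('h::complex_hilbert_space \<rightharpoonup> 'h) \<Rightarrow> bool" where
  "compact_resolvent T \<longleftrightarrow> (\<exists>z\<in>resolvent_set T. compact_operator (resolvent T z))"

definition C0alpha_self_adjoint_on ::
    "real \<Rightarrow> 'e::locally_convex_space set \<Rightarrow> ('e \<Rightarrow> ('h::complex_hilbert_space \<rightharpoonup> 'h)) \<Rightarrow> bool" where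
  "C0alpha_self_adjoint_on \<alpha> U A \<longleftrightarrow>
    (\<exists>V. complex_vector.subspace V \<and> closure V = UNIV \<and>
      (\<forall>u\<in>U. dom (A u) = V \<and> self_adjoint (A u)) \<and>
      (\<forall>v\<in>V. \<forall>w. C0alpha_on \<alpha> U (\<lambda>u. cinner (the (A u v)) w)))"

end

theory Submission imports Defs begin

text \<open>Along a smooth curve \<open>c\<close> write \<open>A t\<close> for \<open>A (c t)\<close> and \<open>lam t\<close> for \<open>lam (c t)\<close>. The uniform
  boundedness principle gives, for \<open>t\<close>, \<open>s\<close> near \<open>t0\<close>,
  \<open>norm (A t v - A s v) \<le> C * \<bar>t - s\<bar> powr \<alpha> * (norm (A t0 v) + norm v)\<close>. An eigenvector of \<open>A r\<close>
  for \<open>lam r\<close>, with \<open>r\<close> between \<open>s\<close> and \<open>t\<close>, is therefore an approximate eigenvector of \<open>A s\<close>, so that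
  \<open>lam r\<close> has distance at most \<open>\<delta> = G * \<bar>t - s\<bar> powr \<alpha>\<close> from an eigenvalue of \<open>A s\<close>. By continuity
  of \<open>lam\<close> the whole interval between \<open>lam s\<close> and \<open>lam t\<close> is covered by the \<open>\<delta>\<close>-balls around the
  eigenvalues of \<open>A s\<close> in a fixed bounded set. The number of these is bounded by some \<open>N\<close> independent
  of \<open>s\<close>, since their unit eigenvectors are orthonormal and lie in one compact set. Hence
  \<open>\<bar>lam t - lam s\<bar> \<le> 2 * N * \<delta>\<close>, and no ordering of the eigenvalues is needed.\<close>

section \<open>Uniform boundedness\<close>

text \<open>Baire category: the closed sets \<open>T n\<close> cover the space, so one of them
  contains a ball, and linearity rescales the bound on that ball to all vectors.\<close>

lemma uniform_boundedness:
  fixes F :: "('a::banach \<Rightarrow> 'b::real_normed_vector) set"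
  assumes lin: "\<And>f. f \<in> F \<Longrightarrow> bounded_linear f"
    and bdd: "\<And>x. \<exists>K. \<forall>f\<in>F. norm (f x) \<le> K"
  shows "\<exists>C>0. \<forall>f\<in>F. \<forall>x. norm (f x) \<le> C * norm x"
proof -
  define T where "T n = (\<Inter>f\<in>F. {x. norm (f x) \<le> real n})" for n
  have cl: "closed (T n)" for n
    unfolding T_def
    by (intro closed_INT ballI closed_Collect_le continuous_intros
        bounded_linear.continuous_on[OF lin] continuous_on_id)
  have cover: "(\<Union>n. T n) = UNIV"
  proof (intro equalityI subset_UNIV subsetI)
    fix x
    obtain K where "\<forall>f\<in>F. norm (f x) \<le> K"
      using bdd by blast
    moreover obtain n where "K \<le> real n"
      using real_arch_simple by blast
    ultimately show "x \<in> (\<Union>n. T n)"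
      unfolding T_def by (force intro: order_trans)
  qed
  have "\<exists>n. interior (T n) \<noteq> {}"
  proof (rule ccontr)
    assume "\<nexists>n. interior (T n) \<noteq> {}"
    then have "euclidean interior_of \<Union>(range T) = {}"
      by (intro Baire_category_alt) (auto simp: completely_metrizable_space_euclidean cl)
    then show False
      by (simp add: cover)
  qed
  then obtain n x e where e: "e > 0" "cball x e \<subseteq> T n"
    by (metis all_not_in_conv mem_interior_cball)
  have x: "norm (f x) \<le> real n" if "f \<in> F" for f
    using e that by (force simp: T_def)
  \<comment> \<open>Adding 1 keeps the constant positive when \<open>n = 0\<close>.\<close>
  have "norm (f y) \<le> (2 * real n + 1) / e * norm y" if "f \<in> F" for f y
  proof (cases "y = 0")
    case True
    then show ?thesis
      using linear_0[OF bounded_linear.linear[OF lin[OF that]]] by simp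
  next
    case False
    interpret f: bounded_linear f
      by (rule lin[OF that])
    have "x + (e / norm y) *\<^sub>R y \<in> cball x e"
      using e False by (simp add: dist_norm)
    then have "norm (f (x + (e / norm y) *\<^sub>R y)) \<le> real n"
      using e that by (force simp: T_def)
    then have "norm (f ((e / norm y) *\<^sub>R y)) \<le> 2 * real n"
      using x[OF that] norm_triangle_ineq4[of "f (x + (e / norm y) *\<^sub>R y)" "f x"]
      by (simp add: f.add)
    then have "e / norm y * norm (f y) \<le> 2 * real n + 1"
      using e by (simp add: f.scaleR)
    then show ?thesis
      using e False by (simp add: field_simps)
  qed
  moreover have "(2 * real n + 1) / e > 0"
    using e by simp
  ultimately show ?thesis
    by blast
qed

section \<open>Hilbert space geometry\<close>

lemma cinner_add_right: "cinner x (y + z) = cinner x y + cinner x z"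
  by (metis cinner_add_left cinner_commute complex_cnj_add)

lemma cinner_scaleC_right: "cinner x (a *\<^sub>C y) = cnj a * cinner x y"
  by (metis cinner_scaleC_left cinner_commute complex_cnj_mult)

lemma cinner_scaleR_left: "cinner (r *\<^sub>R x) y = of_real r * cinner x y"
  by (metis cinner_scaleC_left scaleC_of_real)

lemma cinner_scaleR_right: "cinner x (r *\<^sub>R y) = of_real r * cinner x y"
  by (metis cinner_scaleC_right scaleC_of_real complex_cnj_complex_of_real)

lemma cinner_diff_left: "cinner (x - y) z = cinner x z - cinner y z"
  using cinner_add_left[of "x - y" y z] by simp

lemma cinner_diff_right: "cinner x (y - z) = cinner x y - cinner x z"
  using cinner_add_right[of x "y - z" z] by simp

lemma norm_scaleC: "norm (a *\<^sub>C x) = cmod a * norm x"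
proof -
  have "complex_of_real ((norm (a *\<^sub>C x))\<^sup>2) = (a * cnj a) * complex_of_real ((norm x)\<^sup>2)"
    by (simp only: cinner_self[symmetric] cinner_scaleC_left cinner_scaleC_right ac_simps)
  also have "\<dots> = complex_of_real ((cmod a * norm x)\<^sup>2)"
    using complex_norm_square[of a] by (simp add: power_mult_distrib)
  finally have "(norm (a *\<^sub>C x))\<^sup>2 = (cmod a * norm x)\<^sup>2"
    using of_real_eq_iff by blast
  then show ?thesis
    by (simp add: power2_eq_iff_nonneg)
qed

lemma norm_add_sq: "(norm (x + y))\<^sup>2 = (norm x)\<^sup>2 + (norm y)\<^sup>2 + 2 * Re (cinner x y)"
  for x y :: "'h::complex_hilbert_space"
proof -
  have "(norm (x + y))\<^sup>2 = Re (cinner (x + y) (x + y))"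
    by (simp only: cinner_self Re_complex_of_real)
  also have "\<dots> = Re (cinner x x) + Re (cinner y y) + Re (cinner x y) + Re (cinner y x)"
    by (simp add: cinner_add_left cinner_add_right)
  also have "Re (cinner y x) = Re (cinner x y)"
    by (metis cinner_commute complex_cnj(1) complex.sel(1) cnj.sel(1))
  finally show ?thesis
    by (simp only: cinner_self Re_complex_of_real)
qed

text \<open>The parallelogram law, solved for the difference. It serves both the Cauchy property of
  the images of a minimising sequence and the separation of orthogonal eigenvectors.\<close>

lemma norm_diff_sq: "(norm (x - y))\<^sup>2 = 2 * (norm x)\<^sup>2 + 2 * (norm y)\<^sup>2 - (norm (x + y))\<^sup>2"
  for x y :: "'h::complex_hilbert_space"
  using norm_add_sq[of x y] norm_add_sq[of x "- y"] cinner_scaleR_right[of x "-1" y]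
  by simp

lemma norm_cinner_le: "cmod (cinner x y) \<le> norm x * norm y"
proof (cases "y = 0")
  case True
  then show ?thesis
    using cinner_scaleR_right[of x 0 y] by simp
next
  case False
  \<comment> \<open>\<open>a\<close> is the coefficient of the orthogonal projection of
    \<open>x\<close> onto \<open>y\<close>; expanding the squared norm of the remainder gives
    Cauchy-Schwarz.\<close>
  define a where "a = cinner x y / complex_of_real ((norm y)\<^sup>2)"
  have "Re (cinner x ((- a) *\<^sub>C y)) = - Re (cnj a * cinner x y)"
    by (simp only: cinner_scaleC_right complex_cnj_minus) simp
  also have "cnj a * cinner x y = complex_of_real ((cmod (cinner x y))\<^sup>2 / (norm y)\<^sup>2)"
    using complex_norm_square[of "cinner x y"] by (simp add: a_def field_simps)
  finally have r: "Re (cinner x ((- a) *\<^sub>C y)) = - ((cmod (cinner x y))\<^sup>2 / (norm y)\<^sup>2)"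
    by (simp only: Re_complex_of_real)
  have n: "(norm ((- a) *\<^sub>C y))\<^sup>2 = (cmod (cinner x y))\<^sup>2 / (norm y)\<^sup>2"
    using False
    by (simp only: norm_scaleC) (simp add: a_def norm_divide norm_mult field_simps power2_eq_square)
  have "0 \<le> (norm x)\<^sup>2 - (cmod (cinner x y))\<^sup>2 / (norm y)\<^sup>2"
    using norm_add_sq[of x "(- a) *\<^sub>C y"] r n zero_le_power2[of "norm (x + (- a) *\<^sub>C y)"]
    by simp
  then have "(cmod (cinner x y))\<^sup>2 \<le> (norm x * norm y)\<^sup>2"
    using False by (simp add: field_simps power_mult_distrib)
  then show ?thesis
    by (rule power2_le_imp_le) simp
qed

lemma bounded_linear_cinner_left: "bounded_linear (\<lambda>x. cinner x y)"
  by (rule bounded_linear_intro[where K = "norm y"])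
    (simp_all add: cinner_add_left cinner_scaleR_left scaleR_conv_of_real norm_cinner_le)

lemma bounded_linear_cinner_right: "bounded_linear (cinner x)"
  by (rule bounded_linear_intro[where K = "norm x"])
    (simp_all add: cinner_add_right cinner_scaleR_right scaleR_conv_of_real norm_cinner_le
      mult.commute[of _ "norm x"])

text \<open>Density lets \<open>x - y\<close> itself be used as test vector.\<close>

lemma cinner_eq_dense:
  fixes x y :: "'h::complex_hilbert_space"
  assumes "closure V = UNIV" and eq: "\<And>v. v \<in> V \<Longrightarrow> cinner v x = cinner v y"
  shows "x = y"
proof -
  have "closed {v. cinner v x = cinner v y}"
    by (intro closed_Collect_eq bounded_linear.continuous_on[OF bounded_linear_cinner_left]
        continuous_on_id)
  then have "closure V \<subseteq> {v. cinner v x = cinner v y}"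
    using eq by (intro closure_minimal) auto
  then have "cinner (x - y) x = cinner (x - y) y"
    using assms(1) by blast
  then have "cinner (x - y) (x - y) = 0"
    by (simp add: cinner_diff_right)
  then show ?thesis
    by (simp add: cinner_self)
qed

text \<open>By density the bound extends to \<open>v = x\<close>, where the left side is the square
  of \<open>norm x\<close>.\<close>

lemma norm_le_dense:
  fixes x :: "'h::complex_hilbert_space"
  assumes "closure V = UNIV" "0 \<le> C"
    and le: "\<And>v. v \<in> V \<Longrightarrow> cmod (cinner x v) \<le> C * norm v"
  shows "norm x \<le> C"
proof -
  have "closed {v. cmod (cinner x v) \<le> C * norm v}"
    by (intro closed_Collect_le continuous_intros
        bounded_linear.continuous_on[OF bounded_linear_cinner_right] continuous_on_id)
  then have "closure V \<subseteq> {v. cmod (cinner x v) \<le> C * norm v}"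
    using le by (intro closure_minimal) auto
  then have "cmod (cinner x x) \<le> C * norm x"
    using assms(1) by blast
  then have "norm x * norm x \<le> C * norm x"
    by (simp only: cinner_self norm_of_real abs_power2 power2_eq_square[symmetric])
  then show ?thesis
    using \<open>0 \<le> C\<close> by (cases "x = 0") simp_all
qed

section \<open>Self-adjoint operators with compact resolvent\<close>

lemma self_adjoint_add:
  assumes "self_adjoint T" "x \<in> dom T" "y \<in> dom T"
  shows "x + y \<in> dom T" "the (T (x + y)) = the (T x) + the (T y)"
  using assms unfolding self_adjoint_def linear_operator_def complex_vector.subspace_def by blast+

lemma self_adjoint_scaleC:
  assumes "self_adjoint T" "x \<in> dom T"
  shows "a *\<^sub>C x \<in> dom T" "the (T (a *\<^sub>C x)) = a *\<^sub>C the (T x)"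
  using assms unfolding self_adjoint_def linear_operator_def complex_vector.subspace_def by blast+

lemma self_adjoint_scaleR:
  assumes "self_adjoint T" "x \<in> dom T"
  shows "r *\<^sub>R x \<in> dom T" "the (T (r *\<^sub>R x)) = r *\<^sub>R the (T x)"
  using self_adjoint_scaleC[OF assms, of "complex_of_real r"] by (simp_all add: scaleC_of_real)

lemma self_adjoint_diff:
  assumes "self_adjoint T" "x \<in> dom T" "y \<in> dom T"
  shows "x - y \<in> dom T" "the (T (x - y)) = the (T x) - the (T y)"
  using self_adjoint_add[OF assms(1,2) self_adjoint_scaleR(1)[OF assms(1,3)], of "-1"]
    self_adjoint_scaleR(2)[OF assms(1,3), of "-1"] by simp_all

lemma self_adjoint_symmetric:
  assumes T: "self_adjoint T" and v: "v \<in> dom T" and w: "w \<in> dom T"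
  shows "cinner (the (T v)) w = cinner v (the (T w))"
proof -
  let ?P = "\<lambda>z. \<forall>v\<in>dom T. cinner (the (T v)) w = cinner v z"
  have adj: "adjoint_operator T w = T w" and dense: "closure (dom T) = UNIV"
    using T by (auto simp: self_adjoint_def)
  from adj w have ex: "\<exists>z. ?P z"
    unfolding adjoint_operator_def by (metis domIff)
  \<comment> \<open>Density of the domain makes \<open>z\<close> unique, so \<open>THE\<close> in
    \<open>adjoint_operator\<close> denotes it.\<close>
  then have "\<exists>!z. ?P z"
    using cinner_eq_dense[OF dense] by metis
  then have "?P (THE z. ?P z)"
    by (rule theI')
  moreover have "adjoint_operator T w = Some (THE z. ?P z)"
    unfolding adjoint_operator_def using ex by (rule if_P)
  ultimately show ?thesis
    using v adj by simp
qed

text \<open>This is the inclusion of the domain of the adjoint in \<open>dom T\<close>; limits and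
  the vector \<open>B v\<close> below enter the domain through such a weak identity.\<close>

lemma self_adjoint_maximal:
  assumes T: "self_adjoint T" and z: "\<And>v. v \<in> dom T \<Longrightarrow> cinner (the (T v)) w = cinner v z"
  shows "w \<in> dom T" "the (T w) = z"
proof -
  have adj: "adjoint_operator T w = T w" and dense: "closure (dom T) = UNIV"
    using T by (auto simp: self_adjoint_def)
  from z have "adjoint_operator T w \<noteq> None"
    unfolding adjoint_operator_def by auto
  then show w: "w \<in> dom T"
    using adj by auto
  show "the (T w) = z"
    using z self_adjoint_symmetric[OF T _ w] by (intro cinner_eq_dense[OF dense]) metis
qed

text \<open>Symmetry moves \<open>T\<close> onto the test vector, where the limit passes through the
  inner product; maximality does the rest.\<close>

lemma self_adjoint_closed:
  assumes T: "self_adjoint T" and u: "\<And>n. u n \<in> dom T"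
    and lim: "u \<longlonglongrightarrow> v" "(\<lambda>n. the (T (u n))) \<longlonglongrightarrow> y"
  shows "v \<in> dom T" "the (T v) = y"
proof -
  have *: "cinner (the (T x)) v = cinner x y" if x: "x \<in> dom T" for x
  proof (rule LIMSEQ_unique)
    show "(\<lambda>n. cinner (the (T x)) (u n)) \<longlonglongrightarrow> cinner (the (T x)) v"
      by (rule bounded_linear.tendsto[OF bounded_linear_cinner_right lim(1)])
    show "(\<lambda>n. cinner (the (T x)) (u n)) \<longlonglongrightarrow> cinner x y"
      using bounded_linear.tendsto[OF bounded_linear_cinner_right lim(2)]
      by (simp add: self_adjoint_symmetric[OF T x u])
  qed
  show "v \<in> dom T" "the (T v) = y"
    using self_adjoint_maximal[OF T *] by blast+
qed

section \<open>Compact graph balls and approximate eigenvectors\<close>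

lemma resolvent_apply:
  assumes "z \<in> resolvent_set T" "v \<in> dom T"
  shows "resolvent T z (the (T v) - z *\<^sub>C v) = v"
  using assms inv_into_f_f[of "\<lambda>v. the (T v) - z *\<^sub>C v" "dom T" v]
  unfolding resolvent_def resolvent_set_def bij_betw_def by fast

text \<open>Such a \<open>v\<close> is the resolvent image of
  \<open>the (T v) - z *\<^sub>C v\<close>, whose norm is at most \<open>M + cmod z\<close>, and the
  resolvent carries that ball into a compact set.\<close>

lemma compact_resolvent_graph_ball:
  assumes "compact_resolvent T"
  shows "\<exists>K. compact K \<and> {v \<in> dom T. norm v \<le> 1 \<and> norm (the (T v)) \<le> M} \<subseteq> K"
proof -
  obtain z where z: "z \<in> resolvent_set T" and "compact_operator (resolvent T z)"
    using assms unfolding compact_resolvent_def by blast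
  then have "compact (closure (resolvent T z ` cball 0 (M + cmod z)))"
    unfolding compact_operator_def by blast
  moreover have "v \<in> resolvent T z ` cball 0 (M + cmod z)"
    if "v \<in> dom T" "norm v \<le> 1" "norm (the (T v)) \<le> M" for v
  proof (rule image_eqI)
    show "v = resolvent T z (the (T v) - z *\<^sub>C v)"
      using resolvent_apply[OF z that(1)] by simp
    have "norm (the (T v) - z *\<^sub>C v) \<le> norm (the (T v)) + cmod z * norm v"
      by (metis norm_scaleC norm_triangle_ineq4)
    also have "\<dots> \<le> M + cmod z"
      using that by (intro add_mono mult_left_le) auto
    finally show "the (T v) - z *\<^sub>C v \<in> cball 0 (M + cmod z)"
      by simp
  qed
  ultimately show ?thesis
    by (intro exI[of _ "closure (resolvent T z ` cball 0 (M + cmod z))"] conjI)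
      (auto intro: closure_subset[THEN subsetD])
qed

text \<open>The first-order condition at the minimum \<open>t = 0\<close>: a nonzero
  \<open>a\<close> would make the expression negative for small \<open>t\<close> of the opposite
  sign.\<close>

lemma linear_coefficient_zero:
  fixes a b :: real
  assumes "\<And>t. 0 \<le> t * a + t\<^sup>2 * b"
  shows "a = 0"
proof -
  \<comment> \<open>Only \<open>s > 0\<close> and \<open>s * b < 1\<close> matter: at
    \<open>t = - s * a\<close> the expression equals
    \<open>s * (a * a) * (s * b - 1)\<close>.\<close>
  define s where "s = 1 / (\<bar>b\<bar> + 1)"
  have s: "s > 0" "s * b < 1"
    by (simp_all add: s_def field_simps)
  have "0 \<le> (- s * a) * a + (- s * a)\<^sup>2 * b"
    by (rule assms)
  then have "0 \<le> (s * (a * a)) * (s * b - 1)"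
    by (simp add: power2_eq_square algebra_simps)
  moreover have "s * (a * a) > 0" if "a \<noteq> 0"
    using mult_pos_pos[OF s(1), of "a * a"] not_real_square_gt_zero[of a] that by blast
  ultimately show ?thesis
    using s(2) by (meson diff_less_0_iff_less leD mult_pos_neg)
qed

text \<open>The infimum \<open>m\<close> of \<open>norm ((T - l) x)\<close> over unit vectors is attained, at \<open>v\<close> say; stationarity
  reads \<open>(T - l)\<^sup>2 v = m\<^sup>2 v\<close>, so one of \<open>l + m\<close>, \<open>l - m\<close> is an eigenvalue.\<close>

lemma eigenvalue_near_approximate:
  assumes T: "self_adjoint T" and cpt: "compact_resolvent T"
    and x: "x \<in> dom T" "norm x = 1"
  shows "\<exists>\<mu>. eigenvalue T (complex_of_real \<mu>) \<and> \<bar>\<mu> - l\<bar> \<le> norm (the (T x) - l *\<^sub>R x)"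
proof -
  define B where "B v = the (T v) - l *\<^sub>R v" for v
  define S where "S = {v \<in> dom T. norm v = 1}"
  define m where "m = Inf ((norm \<circ> B) ` S)"
  note sa = self_adjoint_add[OF T] self_adjoint_diff[OF T] self_adjoint_scaleR[OF T]
  have B_add: "B (v + w) = B v + B w" and B_diff: "B (v - w) = B v - B w"
    if "v \<in> dom T" "w \<in> dom T" for v w
    using that by (simp_all add: B_def sa algebra_simps)
  have B_scaleR: "B (r *\<^sub>R v) = r *\<^sub>R B v" if "v \<in> dom T" for v r
    using that by (simp add: B_def sa algebra_simps)
  have bdd: "bdd_below ((norm \<circ> B) ` S)"
    by (rule bdd_belowI[where m = 0]) auto
  have S: "x \<in> S"
    using x by (simp add: S_def)
  have m_le: "m \<le> norm (B v)" if "v \<in> S" for v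
    unfolding m_def using cINF_lower[OF bdd that] by simp
  have m0: "m \<ge> 0"
    unfolding m_def using S by (intro cINF_greatest) auto
  have m_norm: "m * norm v \<le> norm (B v)" if v: "v \<in> dom T" for v
  proof (cases "v = 0")
    case False
    have "m \<le> norm (B ((1 / norm v) *\<^sub>R v))"
      using v False by (intro m_le) (simp add: S_def sa)
    then show ?thesis
      using v False by (simp add: B_scaleR field_simps)
  qed simp
  have m_sq: "m\<^sup>2 * (norm v)\<^sup>2 \<le> (norm (B v))\<^sup>2" if "v \<in> dom T" for v
    using power_mono[OF m_norm[OF that], of 2] m0 by (simp add: power_mult_distrib)

  \<comment> \<open>A minimising sequence of unit vectors stays in a graph ball, hence has a
    convergent subsequence.\<close>
  have "\<exists>v\<in>S. norm (B v) < m + inverse (real (Suc n))" for n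
    using cINF_less_iff[OF _ bdd, of "m + inverse (real (Suc n))"] S
    unfolding m_def[symmetric] by auto
  then obtain u where u: "\<And>n. u n \<in> S" "\<And>n. norm (B (u n)) < m + inverse (real (Suc n))"
    by metis
  have "norm (the (T (u n))) \<le> m + 1 + \<bar>l\<bar>" for n
  proof -
    have "norm (the (T (u n))) \<le> norm (B (u n)) + norm (l *\<^sub>R u n)"
      using norm_triangle_ineq[of "B (u n)" "l *\<^sub>R u n"] by (simp add: B_def)
    moreover have "norm (l *\<^sub>R u n) = \<bar>l\<bar>"
      using u(1)[of n] by (simp add: S_def)
    moreover have "inverse (real (Suc n)) \<le> 1"
      by (simp add: field_simps)
    ultimately show ?thesis
      using u(2)[of n] by linarith
  qed
  then have u_graph: "u n \<in> {v \<in> dom T. norm v \<le> 1 \<and> norm (the (T v)) \<le> m + 1 + \<bar>l\<bar>}" for n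
    using u(1)[of n] by (simp add: S_def)
  obtain K where "compact K"
    "{v \<in> dom T. norm v \<le> 1 \<and> norm (the (T v)) \<le> m + 1 + \<bar>l\<bar>} \<subseteq> K"
    using compact_resolvent_graph_ball[OF cpt] by blast
  with u_graph have "\<forall>n. u n \<in> K" "seq_compact K"
    by (blast, simp add: compact_eq_seq_compact_metric)
  then obtain v r where r: "strict_mono r" and v: "(u \<circ> r) \<longlonglongrightarrow> v"
    unfolding seq_compact_def by metis
  define w where "w = u \<circ> r"
  have w: "w n \<in> S" "w n \<in> dom T" "norm (w n) = 1" for n
    using u(1)[of "r n"] by (auto simp: w_def S_def)
  have lim_w: "w \<longlonglongrightarrow> v"
    using v by (simp add: w_def)
  have lim_m: "(\<lambda>n. norm (B (w n))) \<longlonglongrightarrow> m"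
  proof (rule tendsto_sandwich[where f = "\<lambda>_. m"])
    show "\<forall>\<^sub>F n in sequentially. norm (B (w n)) \<le> m + inverse (real (Suc (r n)))"
      using u(2) by (auto intro!: always_eventually less_imp_le simp: w_def)
    show "(\<lambda>n. m + inverse (real (Suc (r n)))) \<longlonglongrightarrow> m"
      using tendsto_add[OF tendsto_const LIMSEQ_subseq_LIMSEQ[OF LIMSEQ_inverse_real_of_nat r], of m]
      by (simp add: o_def)
  qed (auto intro!: always_eventually m_le w)

  \<comment> \<open>Convergence of \<open>w\<close> alone does not control \<open>B (w n)\<close>,
    as \<open>T\<close> need not be bounded; the parallelogram law together with the minimality of
    \<open>m\<close> does.\<close>
  have "Cauchy (\<lambda>n. B (w n))"
  proof (rule metric_CauchyI)
    fix e :: real assume e: "e > 0"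
    have key: "(norm (B (w i) - B (w j)))\<^sup>2 \<le> 2 * ((norm (B (w i)))\<^sup>2 - m\<^sup>2)
        + 2 * ((norm (B (w j)))\<^sup>2 - m\<^sup>2) + m\<^sup>2 * (norm (w i - w j))\<^sup>2" for i j
    proof -
      have "m\<^sup>2 * (norm (w i + w j))\<^sup>2 \<le> (norm (B (w i) + B (w j)))\<^sup>2"
        using m_sq[of "w i + w j"] w by (simp add: sa B_add)
      moreover have "(norm (w i + w j))\<^sup>2 = 4 - (norm (w i - w j))\<^sup>2"
        using norm_diff_sq[of "w i" "w j"] w by simp
      ultimately show ?thesis
        using norm_diff_sq[of "B (w i)" "B (w j)"] by (simp add: algebra_simps)
    qed
    \<comment> \<open>Each of the three terms of \<open>key\<close> is to be at most
      \<open>e\<^sup>2 / 4\<close>; below, \<open>m + 1\<close> in place of \<open>m\<close> avoids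
      a division by zero.\<close>
    have "(\<lambda>n. (norm (B (w n)))\<^sup>2 - m\<^sup>2) \<longlonglongrightarrow> m\<^sup>2 - m\<^sup>2"
      by (intro tendsto_intros lim_m)
    moreover have "e\<^sup>2 / 8 > 0"
      using e by simp
    ultimately obtain N1 where N1: "\<And>n. n \<ge> N1 \<Longrightarrow> (norm (B (w n)))\<^sup>2 - m\<^sup>2 < e\<^sup>2 / 8"
      by (metis (mono_tags, lifting) diff_self order_tendstoD(2) eventually_sequentially)
    have "e / (2 * (m + 1)) > 0"
      using e m0 by simp
    then obtain N2 where N2: "\<And>i j. i \<ge> N2 \<Longrightarrow> j \<ge> N2 \<Longrightarrow> norm (w i - w j) < e / (2 * (m + 1))"
      using LIMSEQ_imp_Cauchy[OF lim_w] unfolding Cauchy_def dist_norm by meson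
    have "dist (B (w i)) (B (w j)) < e" if "i \<ge> max N1 N2" "j \<ge> max N1 N2" for i j
    proof -
      have "m * norm (w i - w j) \<le> (m + 1) * norm (w i - w j)"
        by (intro mult_right_mono) auto
      also have "\<dots> \<le> e / 2"
        using N2[of i j] that m0 by (simp add: field_simps)
      finally have "(m * norm (w i - w j))\<^sup>2 \<le> (e / 2)\<^sup>2"
        using m0 by (intro power_mono) auto
      then have "m\<^sup>2 * (norm (w i - w j))\<^sup>2 \<le> e\<^sup>2 / 4"
        by (simp add: power_mult_distrib power_divide)
      moreover have "(norm (B (w i)))\<^sup>2 - m\<^sup>2 < e\<^sup>2 / 8" "(norm (B (w j)))\<^sup>2 - m\<^sup>2 < e\<^sup>2 / 8"
        using N1 that by auto
      moreover have "q < d" if "p \<le> d / 4" "x < d / 8" "y < d / 8" "0 < d" "q \<le> 2 * x + 2 * y + p"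
        for p q x y d :: real
        using that by linarith
      ultimately have "(norm (B (w i) - B (w j)))\<^sup>2 < e\<^sup>2"
        using key[of i j] zero_less_power[OF e, of 2] by metis
      then show ?thesis
        using e by (simp add: dist_norm power_less_imp_less_base)
    qed
    then show "\<exists>M. \<forall>i\<ge>M. \<forall>j\<ge>M. dist (B (w i)) (B (w j)) < e"
      by blast
  qed
  then obtain y where lim_B: "(\<lambda>n. B (w n)) \<longlonglongrightarrow> y"
    using Cauchy_convergent_iff convergent_def by metis
  have "(\<lambda>n. the (T (w n))) \<longlonglongrightarrow> y + l *\<^sub>R v"
    using tendsto_add[OF lim_B tendsto_scaleR[OF tendsto_const lim_w, of l]] by (simp add: B_def)
  from self_adjoint_closed[OF T w(2) lim_w this]
  have v_dom: "v \<in> dom T" and Tv: "the (T v) = y + l *\<^sub>R v"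
    by auto
  then have Bv: "B v = y"
    by (simp add: B_def)
  have norm_v: "norm v = 1"
    using LIMSEQ_unique[OF tendsto_norm[OF lim_w]] w by simp
  have norm_Bv: "norm (B v) = m"
    using LIMSEQ_unique[OF lim_m tendsto_norm[OF lim_B]] Bv by simp

  \<comment> \<open>The squared norm of \<open>B (v + t *\<^sub>R h)\<close> minus
    \<open>m\<^sup>2\<close> times that of \<open>v + t *\<^sub>R h\<close> is nonnegative and
    vanishes at \<open>t = 0\<close>.\<close>
  have Re_stat: "Re (cinner (B v) (B h)) = m\<^sup>2 * Re (cinner v h)" if h: "h \<in> dom T" for h
  proof -
    have "0 \<le> t * (2 * (Re (cinner (B v) (B h)) - m\<^sup>2 * Re (cinner v h)))
        + t\<^sup>2 * ((norm (B h))\<^sup>2 - m\<^sup>2 * (norm h)\<^sup>2)" for t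
    proof -
      have "m\<^sup>2 * (norm (v + t *\<^sub>R h))\<^sup>2 \<le> (norm (B v + t *\<^sub>R B h))\<^sup>2"
        using m_sq[of "v + t *\<^sub>R h"] v_dom h by (simp add: sa B_add B_scaleR)
      then show ?thesis
        using norm_add_sq[of v "t *\<^sub>R h"] norm_add_sq[of "B v" "t *\<^sub>R B h"]
        by (simp add: cinner_scaleR_right norm_v norm_Bv power_mult_distrib algebra_simps)
    qed
    then show ?thesis
      using linear_coefficient_zero by fastforce
  qed
  have stat: "cinner (B h) (B v) = cinner h (m\<^sup>2 *\<^sub>R v)" if h: "h \<in> dom T" for h
  proof -
    \<comment> \<open>Testing with \<open>\<i> *\<^sub>C h\<close> turns the real part into the
      imaginary part.\<close>
    have Bi: "B (\<i> *\<^sub>C h) = \<i> *\<^sub>C B h"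
      using h by (simp add: B_def self_adjoint_scaleC[OF T] scaleC_of_real[symmetric]
          complex_vector.scale_right_diff_distrib mult.commute)
    have "Im (cinner (B v) (B h)) = m\<^sup>2 * Im (cinner v h)"
      using Re_stat[OF self_adjoint_scaleC(1)[OF T h, of \<i>]]
      by (simp add: Bi cinner_scaleC_right)
    then have "cinner (B v) (B h) = cinner (m\<^sup>2 *\<^sub>R v) h"
      using Re_stat[OF h] by (simp add: complex_eq_iff cinner_scaleR_left)
    then show ?thesis
      by (metis cinner_commute)
  qed
  \<comment> \<open>Moving \<open>l\<close> to the other side gives the weak identity that places
    \<open>B v\<close> in the domain, with \<open>B (B v) = m\<^sup>2 *\<^sub>R v\<close>.\<close>
  have "cinner (the (T h)) (B v) = cinner h (m\<^sup>2 *\<^sub>R v + l *\<^sub>R B v)" if "h \<in> dom T" for h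
    using stat[OF that] unfolding B_def[of h]
    by (simp add: cinner_diff_left cinner_add_right cinner_scaleR_left cinner_scaleR_right)
      (simp add: algebra_simps)
  from self_adjoint_maximal[OF T this]
  have Bv_dom: "B v \<in> dom T" and TBv: "the (T (B v)) = m\<^sup>2 *\<^sub>R v + l *\<^sub>R B v"
    by auto
  \<comment> \<open>Either \<open>B v + m *\<^sub>R v\<close> is an eigenvector for
    \<open>l + m\<close>, or it vanishes and \<open>v\<close> is one for
    \<open>l - m\<close>.\<close>
  have "\<exists>\<mu>. eigenvalue T (complex_of_real \<mu>) \<and> \<bar>\<mu> - l\<bar> = m"
  proof (cases "B v + m *\<^sub>R v = 0")
    case False
    have "the (T (B v + m *\<^sub>R v)) = (l + m) *\<^sub>R (B v + m *\<^sub>R v)"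
      using Bv_dom v_dom TBv Tv Bv by (simp add: sa algebra_simps power2_eq_square)
    then have "T (B v + m *\<^sub>R v) = Some (complex_of_real (l + m) *\<^sub>C (B v + m *\<^sub>R v))"
      using Bv_dom v_dom sa(1,5) unfolding scaleC_of_real by (metis domD option.sel)
    then show ?thesis
      using False m0 unfolding eigenvalue_def by (intro exI[of _ "l + m"]) auto
  next
    case True
    then have "the (T v) = (l - m) *\<^sub>R v"
      unfolding B_def by (simp add: algebra_simps eq_neg_iff_add_eq_0)
    then have "T v = Some (complex_of_real (l - m) *\<^sub>C v)"
      using v_dom unfolding scaleC_of_real by (metis domD option.sel)
    moreover have "v \<noteq> 0"
      using norm_v by auto
    ultimately have "eigenvalue T (complex_of_real (l - m))"
      unfolding eigenvalue_def by blast
    then show ?thesis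
      using m0 by (intro exI[of _ "l - m"]) simp
  qed
  then show ?thesis
    using m_le[OF S] by (auto simp: B_def)
qed

section \<open>Counting eigenvalues and covering intervals\<close>

lemma eigenvalue_unit_vector:
  assumes T: "self_adjoint T" and "eigenvalue T (complex_of_real \<mu>)"
  shows "\<exists>v\<in>dom T. norm v = 1 \<and> the (T v) = \<mu> *\<^sub>R v"
proof -
  obtain v where v: "v \<noteq> 0" "T v = Some (\<mu> *\<^sub>R v)"
    using assms(2) unfolding eigenvalue_def scaleC_of_real by blast
  then have "v \<in> dom T"
    by blast
  then show ?thesis
    using v self_adjoint_scaleR[OF T, of v "1 / norm v"]
    by (intro bexI[of _ "(1 / norm v) *\<^sub>R v"]) (simp_all add: mult.commute)
qed

text \<open>Finitely many balls of radius \<open>e / 2\<close> cover \<open>K\<close>, and each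
  contains at most one point of a separated set.\<close>

lemma compact_separated_card_bound:
  fixes K :: "'a::metric_space set"
  assumes "compact K" "e > 0"
  shows "\<exists>N. \<forall>S\<subseteq>K. (\<forall>x\<in>S. \<forall>y\<in>S. x \<noteq> y \<longrightarrow> e \<le> dist x y) \<longrightarrow> finite S \<and> card S \<le> N"
proof -
  obtain k where k: "finite k" "K \<subseteq> (\<Union>x\<in>k. ball x (e / 2))"
    using seq_compact_imp_totally_bounded[of K] assms compact_eq_seq_compact_metric half_gt_zero
    by metis
  have "finite S \<and> card S \<le> card k"
    if S: "S \<subseteq> K" "\<forall>x\<in>S. \<forall>y\<in>S. x \<noteq> y \<longrightarrow> e \<le> dist x y" for S
  proof -
    have "\<forall>x\<in>S. \<exists>c\<in>k. dist c x < e / 2"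
      using k(2) S(1) by fastforce
    then obtain g where g: "\<And>x. x \<in> S \<Longrightarrow> g x \<in> k \<and> dist (g x) x < e / 2"
      by metis
    have "inj_on g S"
    proof (rule inj_onI, rule ccontr)
      fix x y assume xy: "x \<in> S" "y \<in> S" "g x = g y" "x \<noteq> y"
      have "dist x y < e"
        using dist_triangle_half_r[of "g x" x e y] g[OF xy(1)] g[OF xy(2)] xy(3) by simp
      then show False
        using S(2) xy by force
    qed
    then show ?thesis
      using g k(1) by (meson card_inj_on_le image_subsetI inj_on_finite)
  qed
  then show ?thesis
    by blast
qed

text \<open>Unit eigenvectors for distinct eigenvalues are at distance \<open>sqrt 2\<close> from each other.\<close>

lemma eigenvalue_count_bound:
  fixes K :: "'h::complex_hilbert_space set"
  assumes "compact K"
  shows "\<exists>N. \<forall>T M. self_adjoint T \<and> (\<forall>v\<in>dom T. norm v = 1 \<and> norm (the (T v)) \<le> M \<longrightarrow> v \<in> K) \<longrightarrow>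
    finite {\<mu>. \<bar>\<mu>\<bar> \<le> M \<and> eigenvalue T (complex_of_real \<mu>)} \<and>
    card {\<mu>. \<bar>\<mu>\<bar> \<le> M \<and> eigenvalue T (complex_of_real \<mu>)} \<le> N"
proof -
  obtain N where N: "\<And>S. S \<subseteq> K \<Longrightarrow> (\<And>x y. x \<in> S \<Longrightarrow> y \<in> S \<Longrightarrow> x \<noteq> y \<Longrightarrow> 1 \<le> dist x y) \<Longrightarrow>
      finite S \<and> card S \<le> N"
    using compact_separated_card_bound[OF assms zero_less_one] by metis
  have count: "finite E \<and> card E \<le> N"
    if T: "self_adjoint T" and K: "\<And>v. v \<in> dom T \<Longrightarrow> norm v = 1 \<Longrightarrow> norm (the (T v)) \<le> M \<Longrightarrow> v \<in> K"
      and E: "E = {\<mu>. \<bar>\<mu>\<bar> \<le> M \<and> eigenvalue T (complex_of_real \<mu>)}" for T M E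
  proof -
    have "\<forall>\<mu>\<in>E. \<exists>v\<in>dom T. norm v = 1 \<and> the (T v) = \<mu> *\<^sub>R v"
      using eigenvalue_unit_vector[OF T] E by blast
    then obtain g where g: "\<And>\<mu>. \<mu> \<in> E \<Longrightarrow> g \<mu> \<in> dom T" "\<And>\<mu>. \<mu> \<in> E \<Longrightarrow> norm (g \<mu>) = 1"
        "\<And>\<mu>. \<mu> \<in> E \<Longrightarrow> the (T (g \<mu>)) = \<mu> *\<^sub>R g \<mu>"
      by metis
    have sep: "1 \<le> dist (g \<mu>) (g \<nu>)" if "\<mu> \<in> E" "\<nu> \<in> E" "\<mu> \<noteq> \<nu>" for \<mu> \<nu>
    proof -
      have "complex_of_real \<mu> * cinner (g \<mu>) (g \<nu>) = complex_of_real \<nu> * cinner (g \<mu>) (g \<nu>)"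
        using self_adjoint_symmetric[OF T g(1) g(1), OF that(1,2)] g(3) that
        by (simp add: cinner_scaleR_left cinner_scaleR_right)
      then have "cinner (g \<mu>) (g \<nu>) = 0"
        using that(3) by simp
      then have "(norm (g \<mu> + g \<nu>))\<^sup>2 = 2"
        using norm_add_sq[of "g \<mu>" "g \<nu>"] g(2) that by simp
      then have "(norm (g \<mu> - g \<nu>))\<^sup>2 = 2"
        using norm_diff_sq[of "g \<mu>" "g \<nu>"] g(2) that by simp
      then show ?thesis
        by (simp add: dist_norm power2_le_imp_le)
    qed
    have "g ` E \<subseteq> K"
      using g K E by auto
    with sep have "finite (g ` E) \<and> card (g ` E) \<le> N"
      by (intro N) auto
    moreover have "inj_on g E"
      using sep by (metis dist_self inj_onI not_one_le_zero)
    ultimately show ?thesis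
      by (simp add: card_image finite_image_iff)
  qed
  show ?thesis
    by (intro exI[of _ N] allI impI, elim conjE) (rule count[OF _ _ refl], auto)
qed

text \<open>Subadditivity of Lebesgue measure: each ball has length
  \<open>2 * \<delta>\<close>.\<close>

lemma interval_covered_by_balls_length:
  fixes a b \<delta> :: real
  assumes "finite S" "0 \<le> \<delta>" and cover: "{a..b} \<subseteq> (\<Union>x\<in>S. cball x \<delta>)"
  shows "b - a \<le> 2 * \<delta> * real (card S)"
proof (cases "a \<le> b")
  case True
  have "measure lborel {a..b} \<le> measure lborel (\<Union>x\<in>S. cball x \<delta>)"
    using assms by (intro measure_mono_fmeasurable fmeasurable_compact compact_UN) auto
  also have "\<dots> \<le> (\<Sum>x\<in>S. measure lborel (cball x \<delta>))"
    using assms(1) by (intro measure_UNION_le) auto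
  also have "\<dots> = 2 * \<delta> * real (card S)"
    using assms(2) by (simp add: cball_eq_atLeastAtMost)
  finally show ?thesis
    using True by simp
next
  case False
  moreover have "0 \<le> 2 * \<delta> * real (card S)"
    using assms(2) by simp
  ultimately show ?thesis
    by linarith
qed

section \<open>Hoelder continuous families\<close>

text \<open>Finitely many of the neighbourhoods in \<open>C0alpha\<close> cover \<open>K\<close>;
  since they are also given at diagonal points, \<open>K\<close> may meet the diagonal.\<close>

lemma C0alpha_bounded_on_compact:
  assumes "C0alpha \<alpha> f" "compact K"
  shows "\<exists>C. \<forall>t s. (t, s) \<in> K \<longrightarrow> t \<noteq> s \<longrightarrow> norm ((f t - f s) /\<^sub>R (\<bar>t - s\<bar> powr \<alpha>)) \<le> C"
proof -
  define q where "q = (\<lambda>(t, s). (f t - f s) /\<^sub>R (\<bar>t - s\<bar> powr \<alpha>))"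
  have "\<forall>p. \<exists>N. open N \<and> p \<in> N \<and> bounded (q ` {(t, s) \<in> N. t \<noteq> s})"
    using assms(1) unfolding C0alpha_def q_def by blast
  from choice[OF this] obtain N where
      N: "\<And>p. open (N p)" "\<And>p. p \<in> N p" "\<And>p. bounded (q ` {(t, s) \<in> N p. t \<noteq> s})"
    by blast
  obtain D where D: "finite D" "K \<subseteq> (\<Union>p\<in>D. N p)"
    by (rule compactE_image[OF assms(2), of K N]) (use N in auto)
  have "bounded (\<Union>p\<in>D. q ` {(t, s) \<in> N p. t \<noteq> s})"
    using D(1) N(3) by (intro bounded_UN) auto
  then obtain C where C: "\<And>x. x \<in> (\<Union>p\<in>D. q ` {(t, s) \<in> N p. t \<noteq> s}) \<Longrightarrow> norm x \<le> C"
    unfolding bounded_iff by blast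
  have "norm (q (t, s)) \<le> C" if ts: "(t, s) \<in> K" "t \<noteq> s" for t s
  proof (rule C)
    obtain p where "p \<in> D" "(t, s) \<in> N p"
      using D(2) ts(1) by blast
    then show "q (t, s) \<in> (\<Union>p\<in>D. q ` {(t, s) \<in> N p. t \<noteq> s})"
      using ts(2) by (intro UN_I[of p] imageI) auto
  qed
  then show ?thesis
    by (auto simp: q_def)
qed

text \<open>Weak Hoelder bounds become uniform by two uses of \<open>uniform_boundedness\<close>:
  over \<open>w\<close> with \<open>v\<close> fixed, then over \<open>x\<close> with
  \<open>v = R x\<close>, which trades the graph norm of \<open>A t0\<close> for the norm of
  \<open>x\<close>.\<close>

lemma C0alpha_self_adjoint_bound:
  fixes A :: "real \<Rightarrow> ('h::complex_hilbert_space \<rightharpoonup> 'h)"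
  assumes dom: "\<And>t. dom (A t) = V" and sa: "\<And>t. self_adjoint (A t)"
    and hold: "\<And>v w. v \<in> V \<Longrightarrow> C0alpha \<alpha> (\<lambda>t. cinner (the (A t v)) w)"
    and z: "z \<in> resolvent_set (A t0)" and I: "compact I"
  shows "\<exists>C>0. \<forall>t\<in>I. \<forall>s\<in>I. \<forall>v\<in>V. norm (the (A t v) - the (A s v)) \<le>
    C * \<bar>t - s\<bar> powr \<alpha> * (norm (the (A t0 v)) + norm v)"
proof -
  define Q where "Q = {(t, s). t \<in> I \<and> s \<in> I \<and> t \<noteq> s}"
  \<comment> \<open>\<open>D p\<close> is the difference quotient operator on \<open>V\<close> for
    the pair \<open>p\<close>; the aim is a bound for \<open>D p \<circ> R\<close> uniform in
    \<open>p\<close>.\<close>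
  define D where "D p v = (the (A (fst p) v) - the (A (snd p) v)) /\<^sub>R (\<bar>fst p - snd p\<bar> powr \<alpha>)"
    for p v
  define R where "R = resolvent (A t0) z"
  have dense: "closure V = UNIV"
    using sa[of t0] dom[of t0] by (simp add: self_adjoint_def)
  have D_sym: "cinner (D p v) w = cinner v (D p w)" if "v \<in> V" "w \<in> V" for p v w
    using that by (simp add: D_def cinner_scaleR_left cinner_scaleR_right cinner_diff_left
        cinner_diff_right self_adjoint_symmetric[OF sa] dom)
  have pointwise: "\<exists>C. \<forall>p\<in>Q. norm (D p v) \<le> C" if v: "v \<in> V" for v
  proof -
    have "\<exists>K. \<forall>f\<in>(\<lambda>p. cinner (D p v)) ` Q. norm (f w) \<le> K" for w
    proof -
      obtain C where C: "\<And>t s. (t, s) \<in> I \<times> I \<Longrightarrow> t \<noteq> s \<Longrightarrow>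
          norm ((cinner (the (A t v)) w - cinner (the (A s v)) w) /\<^sub>R (\<bar>t - s\<bar> powr \<alpha>)) \<le> C"
        using C0alpha_bounded_on_compact[OF hold[OF v, of w] compact_Times[OF I I]] by blast
      have "norm (cinner (D p v) w) \<le> C" if "p \<in> Q" for p
        using that C[of "fst p" "snd p"]
        by (auto simp: Q_def D_def cinner_scaleR_left cinner_diff_left scaleR_conv_of_real)
      then show ?thesis
        by blast
    qed
    then obtain C where C: "C > 0" "\<forall>f\<in>(\<lambda>p. cinner (D p v)) ` Q. \<forall>w. norm (f w) \<le> C * norm w"
      using uniform_boundedness[of "(\<lambda>p. cinner (D p v)) ` Q"] bounded_linear_cinner_right by blast
    \<comment> \<open>A bound on the functional \<open>cinner (D p v)\<close> is a bound on its
      representing vector.\<close>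
    then have "norm (D p v) \<le> C" if "p \<in> Q" for p
      using that by (intro norm_le_dense[of UNIV]) auto
    then show ?thesis
      by blast
  qed
  have R: "bounded_linear R" and "bij_betw (\<lambda>v. the (A t0 v) - z *\<^sub>C v) V UNIV"
    using z unfolding resolvent_set_def R_def dom by blast+
  then have R_in: "R x \<in> V" for x
    unfolding R_def resolvent_def dom by (metis UNIV_I bij_betw_def inv_into_into)

  text \<open>By symmetry \<open>x \<mapsto> \<langle>D p (R x), w\<rangle>\<close> is continuous without knowing that \<open>D p \<circ> R\<close> is, so the
    closed graph theorem is not needed.\<close>
  define F where "F = (\<lambda>(p, w) x. cinner (R x) (D p w) /\<^sub>R norm w) ` (Q \<times> V)"
  have "\<exists>C>0. \<forall>f\<in>F. \<forall>x. norm (f x) \<le> C * norm x"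
  proof (rule uniform_boundedness)
    show "bounded_linear f" if "f \<in> F" for f
      using that unfolding F_def
      by (auto intro!: bounded_linear_const_scaleR
          bounded_linear_compose[OF bounded_linear_cinner_left R])
    show "\<exists>K. \<forall>f\<in>F. norm (f x) \<le> K" for x
    proof -
      obtain C where C: "\<And>p. p \<in> Q \<Longrightarrow> norm (D p (R x)) \<le> C"
        using pointwise[OF R_in] by blast
      have "norm (cinner (R x) (D p w) /\<^sub>R norm w) \<le> \<bar>C\<bar>" if "p \<in> Q" "w \<in> V" for p w
      proof -
        have "norm (cinner (R x) (D p w)) \<le> norm (D p (R x)) * norm w"
          using that by (simp add: D_sym[symmetric] R_in norm_cinner_le)
        also have "\<dots> \<le> \<bar>C\<bar> * norm w"
          using C[OF that(1)] by (intro mult_right_mono) auto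
        finally show ?thesis
          by (cases "w = 0") (simp_all add: field_simps)
      qed
      then show ?thesis
        by (intro exI[of _ "\<bar>C\<bar>"]) (auto simp: F_def)
    qed
  qed
  then obtain C where C: "C > 0" "\<And>f x. f \<in> F \<Longrightarrow> norm (f x) \<le> C * norm x"
    by blast
  have C_Q: "norm (cinner (R x) (D p w) /\<^sub>R norm w) \<le> C * norm x" if "p \<in> Q" "w \<in> V" for p w x
  proof (rule C(2))
    show "(\<lambda>x. cinner (R x) (D p w) /\<^sub>R norm w) \<in> F"
      unfolding F_def using that by (intro image_eqI[of _ _ "(p, w)"]) auto
  qed
  have D_le: "norm (D p (R x)) \<le> C * norm x" if p: "p \<in> Q" for p x
  proof (rule norm_le_dense[OF dense])
    fix w assume w: "w \<in> V"
    show "cmod (cinner (D p (R x)) w) \<le> C * norm x * norm w"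
    proof (cases "w = 0")
      case True
      then show ?thesis
        using norm_cinner_le[of "D p (R x)" w] by simp
    next
      case False
      then show ?thesis
        using C_Q[OF p w, of x] w by (simp add: D_sym R_in field_simps)
    qed
  qed (use C(1) in simp)
  \<comment> \<open>The factor compares the norm of \<open>the (A t0 v) - z *\<^sub>C v\<close> with
    the graph norm of \<open>v\<close>.\<close>
  define C' where "C' = C * (1 + cmod z)"
  have "norm (the (A t v) - the (A s v)) \<le> C' * \<bar>t - s\<bar> powr \<alpha> * (norm (the (A t0 v)) + norm v)"
    if ts: "t \<in> I" "s \<in> I" and v: "v \<in> V" for t s v
  proof (cases "t = s")
    case False
    define x where "x = the (A t0 v) - z *\<^sub>C v"
    have "R x = v"
      unfolding R_def x_def using resolvent_apply[OF z] v dom by simp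
    then have "norm (D (t, s) v) \<le> C * norm x"
      using D_le[of "(t, s)" x] ts False by (simp add: Q_def)
    moreover have "norm x \<le> norm (the (A t0 v)) + cmod z * norm v"
      unfolding x_def by (metis norm_scaleC norm_triangle_ineq4)
    moreover have "\<dots> \<le> (1 + cmod z) * (norm (the (A t0 v)) + norm v)"
      by (simp add: algebra_simps)
    ultimately have "norm (D (t, s) v) \<le> C' * (norm (the (A t0 v)) + norm v)"
      using C(1) unfolding C'_def by (metis (no_types, opaque_lifting) mult.assoc mult_left_mono
          order_trans less_imp_le)
    moreover have "norm (D (t, s) v) = norm (the (A t v) - the (A s v)) / \<bar>t - s\<bar> powr \<alpha>"
      by (simp add: D_def divide_inverse mult.commute)
    ultimately show ?thesis
      using False by (simp add: pos_divide_le_eq mult_ac)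
  qed simp
  moreover have "C' > 0"
    unfolding C'_def using C(1) by (simp add: add_pos_nonneg)
  ultimately show ?thesis
    by blast
qed

text \<open>The constants \<open>d\<close>, \<open>G\<close>, \<open>M\<close>, \<open>K\<close> and
  \<open>N\<close> are fixed before \<open>t\<close> and \<open>s\<close> are chosen; the common
  domain lets graph norms of nearby operators be compared with that of \<open>A t0\<close>.\<close>

lemma continuous_eigenvalue_local_Hoelder:
  fixes A :: "real \<Rightarrow> ('h::complex_hilbert_space \<rightharpoonup> 'h)" and lam :: "real \<Rightarrow> real"
  assumes dom: "\<And>t. dom (A t) = V" and sa: "\<And>t. self_adjoint (A t)"
    and hold: "\<And>v w. v \<in> V \<Longrightarrow> C0alpha \<alpha> (\<lambda>t. cinner (the (A t v)) w)"
    and cpt: "\<And>t. compact_resolvent (A t)" and \<alpha>: "0 < \<alpha>"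
    and cont: "continuous_on UNIV lam"
    and ev: "\<And>t. eigenvalue (A t) (complex_of_real (lam t))"
  shows "\<exists>d>0. \<exists>L. \<forall>t\<in>ball t0 d. \<forall>s\<in>ball t0 d. \<bar>lam t - lam s\<bar> \<le> L * \<bar>t - s\<bar> powr \<alpha>"
proof -
  obtain z where z: "z \<in> resolvent_set (A t0)"
    using cpt[of t0] unfolding compact_resolvent_def by blast
  obtain C where C: "C > 0" and "\<forall>t\<in>cball t0 1. \<forall>s\<in>cball t0 1. \<forall>v\<in>V.
      norm (the (A t v) - the (A s v)) \<le> C * \<bar>t - s\<bar> powr \<alpha> * (norm (the (A t0 v)) + norm v)"
    using C0alpha_self_adjoint_bound[OF dom sa hold z, of "cball t0 1"] by auto
  then have bound: "norm (the (A t v) - the (A s v)) \<le>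
      C * \<bar>t - s\<bar> powr \<alpha> * (norm (the (A t0 v)) + norm v)"
    if "t \<in> cball t0 1" "s \<in> cball t0 1" "v \<in> V" for t s v
    using that by blast
  have "bounded (lam ` cball t0 1)"
    by (intro compact_imp_bounded compact_continuous_image continuous_on_subset[OF cont]) auto
  then obtain L where L: "L > 0" "\<And>t. t \<in> cball t0 1 \<Longrightarrow> \<bar>lam t\<bar> \<le> L"
    unfolding bounded_pos by auto
  \<comment> \<open>This gives \<open>C * d powr \<alpha> \<le> 1 / 2\<close>, so that the term with
    \<open>A t0 v\<close> can be absorbed in \<open>graph\<close>; the 1 keeps
    \<open>ball t0 d\<close> inside \<open>cball t0 1\<close>.\<close>
  define d where "d = min 1 ((1 / (2 * C)) powr (1 / \<alpha>))"
  have d: "0 < d" "d \<le> 1"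
    using C by (auto simp: d_def)
  have "d powr \<alpha> \<le> ((1 / (2 * C)) powr (1 / \<alpha>)) powr \<alpha>"
    using \<alpha> d by (intro powr_mono2) (auto simp: d_def)
  also have "\<dots> = 1 / (2 * C)"
    using \<alpha> C by (simp add: powr_powr)
  finally have d_powr: "C * d powr \<alpha> \<le> 1 / 2"
    using C by (simp add: field_simps)

  have graph: "norm (the (A t0 v)) \<le> 2 * norm (the (A t v)) + norm v"
    if t: "t \<in> ball t0 d" and v: "v \<in> V" for t v
  proof -
    have "\<bar>t0 - t\<bar> powr \<alpha> \<le> d powr \<alpha>"
      using t \<alpha> by (intro powr_mono2) (auto simp: dist_real_def)
    then have "C * \<bar>t0 - t\<bar> powr \<alpha> \<le> 1 / 2"
      using d_powr C by (meson mult_left_mono less_imp_le order_trans)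
    then have "C * \<bar>t0 - t\<bar> powr \<alpha> * (norm (the (A t0 v)) + norm v)
        \<le> 1 / 2 * (norm (the (A t0 v)) + norm v)"
      by (intro mult_right_mono) auto
    moreover have "norm (the (A t0 v) - the (A t v)) \<le>
        C * \<bar>t0 - t\<bar> powr \<alpha> * (norm (the (A t0 v)) + norm v)"
      using t d v by (intro bound) auto
    ultimately show ?thesis
      using norm_triangle_ineq2[of "the (A t0 v)" "the (A t v)"] by (simp add: field_simps)
  qed

  \<comment> \<open>For a unit eigenvector \<open>v\<close> of \<open>A r\<close>,
    \<open>graph\<close> bounds \<open>norm (the (A t0 v)) + norm v\<close> by
    \<open>2 * L + 2\<close>.\<close>
  define G where "G = C * (2 * L + 2)"
  have G: "G > 0"
    using C L by (simp add: G_def)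
  \<comment> \<open>As \<open>\<bar>t - s\<bar> \<le> 2\<close>, this gives
    \<open>L + \<delta> \<le> M\<close>, so every eigenvalue within \<open>\<delta>\<close> of some
    \<open>lam r\<close> is counted.\<close>
  define M where "M = L + G * 2 powr \<alpha>"
  \<comment> \<open>By \<open>graph\<close>, unit vectors with
    \<open>norm (the (A s v)) \<le> M\<close> satisfy the bound \<open>2 * M + 1\<close>, so one
    \<open>K\<close> serves every \<open>s\<close> in \<open>ball t0 d\<close>.\<close>
  obtain K where K: "compact K"
      "{v \<in> dom (A t0). norm v \<le> 1 \<and> norm (the (A t0 v)) \<le> 2 * M + 1} \<subseteq> K"
    using compact_resolvent_graph_ball[OF cpt] by blast
  obtain N where N: "\<And>T M. self_adjoint T \<Longrightarrow>
      (\<And>v. v \<in> dom T \<Longrightarrow> norm v = 1 \<Longrightarrow> norm (the (T v)) \<le> M \<Longrightarrow> v \<in> K) \<Longrightarrow>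
      finite {\<mu>. \<bar>\<mu>\<bar> \<le> M \<and> eigenvalue T (complex_of_real \<mu>)} \<and>
      card {\<mu>. \<bar>\<mu>\<bar> \<le> M \<and> eigenvalue T (complex_of_real \<mu>)} \<le> N"
    using eigenvalue_count_bound[OF K(1)] by meson

  have "\<bar>lam t - lam s\<bar> \<le> (2 * G * real N) * \<bar>t - s\<bar> powr \<alpha>"
    if t: "t \<in> ball t0 d" and s: "s \<in> ball t0 d" for t s
  proof -
    define \<delta> where "\<delta> = G * \<bar>t - s\<bar> powr \<alpha>"
    define S where "S = {\<mu>. \<bar>\<mu>\<bar> \<le> M \<and> eigenvalue (A s) (complex_of_real \<mu>)}"
    have \<delta>0: "0 \<le> \<delta>"
      using G by (simp add: \<delta>_def)
    have "\<bar>t - s\<bar> powr \<alpha> \<le> 2 powr \<alpha>"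
      using t s d \<alpha> by (intro powr_mono2) (auto simp: dist_real_def)
    then have \<delta>_le: "L + \<delta> \<le> M"
      using G by (simp add: \<delta>_def M_def)
    have S: "finite S" "card S \<le> N"
    proof -
      have "v \<in> K" if "v \<in> dom (A s)" "norm v = 1" "norm (the (A s v)) \<le> M" for v
        using graph[OF s, of v] that K(2) dom by force
      then show "finite S" "card S \<le> N"
        using N[OF sa, of s M] unfolding S_def by blast+
    qed
    have near: "\<exists>\<mu>\<in>S. \<bar>\<mu> - lam r\<bar> \<le> \<delta>" if r: "r \<in> closed_segment s t" for r
    proof -
      have r_ball: "r \<in> ball t0 d"
        using closed_segment_subset[OF s t convex_ball] r by blast
      then have lam_r: "\<bar>lam r\<bar> \<le> L"
        using d by (intro L) auto
      obtain v where v: "v \<in> V" "norm v = 1" "the (A r v) = lam r *\<^sub>R v"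
        using eigenvalue_unit_vector[OF sa ev, of r] dom by blast
      have "\<bar>s - r\<bar> \<le> \<bar>t - s\<bar>"
        using r by (auto simp: closed_segment_eq_real_ivl split: if_splits)
      then have "\<bar>s - r\<bar> powr \<alpha> \<le> \<bar>t - s\<bar> powr \<alpha>"
        using \<alpha> by (intro powr_mono2) auto
      moreover have "norm (the (A t0 v)) + norm v \<le> 2 * L + 2"
        using graph[OF r_ball v(1)] v lam_r by simp
      moreover have "norm (the (A s v) - lam r *\<^sub>R v) \<le>
          C * \<bar>s - r\<bar> powr \<alpha> * (norm (the (A t0 v)) + norm v)"
        unfolding v(3)[symmetric] using s r_ball d v(1) by (intro bound) auto
      ultimately have "norm (the (A s v) - lam r *\<^sub>R v) \<le> C * \<bar>t - s\<bar> powr \<alpha> * (2 * L + 2)"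
        using C by (elim order_trans) (intro mult_mono mult_nonneg_nonneg order_refl; simp)
      then have "norm (the (A s v) - lam r *\<^sub>R v) \<le> \<delta>"
        by (simp add: \<delta>_def G_def mult_ac)
      moreover obtain \<mu> where "eigenvalue (A s) (complex_of_real \<mu>)"
          "\<bar>\<mu> - lam r\<bar> \<le> norm (the (A s v) - lam r *\<^sub>R v)"
        using eigenvalue_near_approximate[OF sa cpt, of v s "lam r"] v dom by blast
      ultimately show ?thesis
        using lam_r \<delta>_le by (intro bexI[of _ \<mu>]) (auto simp: S_def)
    qed
    \<comment> \<open>The intermediate value property; \<open>min\<close> and \<open>max\<close>
      treat both orders of \<open>lam s\<close> and \<open>lam t\<close> at once.\<close>
    have "{min (lam s) (lam t)..max (lam s) (lam t)} \<subseteq> lam ` closed_segment s t"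
    proof -
      have "connected (lam ` closed_segment s t)"
        by (intro connected_continuous_image continuous_on_subset[OF cont]) auto
      then show ?thesis
        by (rule connected_contains_Icc) (auto simp: min_def max_def)
    qed
    also have "\<dots> \<subseteq> (\<Union>\<mu>\<in>S. cball \<mu> \<delta>)"
      using near by (force simp: dist_real_def)
    finally have "max (lam s) (lam t) - min (lam s) (lam t) \<le> 2 * \<delta> * real (card S)"
      using interval_covered_by_balls_length[OF S(1) \<delta>0] by blast
    also have "\<dots> \<le> 2 * \<delta> * real N"
      using S(2) \<delta>0 by (intro mult_left_mono) auto
    finally show ?thesis
      by (simp add: \<delta>_def max_def min_def mult_ac split: if_splits)
  qed
  then show ?thesis
    using d(1) by blast
qed

text \<open>Near a diagonal point the Hoelder estimate bounds the quotient; elsewhere its continuity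
  on a compact product of balls does.\<close>

lemma C0alpha_if_local_Hoelder:
  fixes f :: "real \<Rightarrow> real"
  assumes cont: "continuous_on UNIV f"
    and loc: "\<And>t0. \<exists>d>0. \<exists>L. \<forall>t\<in>ball t0 d. \<forall>s\<in>ball t0 d. \<bar>f t - f s\<bar> \<le> L * \<bar>t - s\<bar> powr \<alpha>"
  shows "C0alpha \<alpha> f"
  unfolding C0alpha_def
proof
  let ?q = "\<lambda>(t, s). (f t - f s) /\<^sub>R (\<bar>t - s\<bar> powr \<alpha>)"
  fix p :: "real \<times> real"
  obtain a b where p: "p = (a, b)"
    by force
  have "\<exists>r>0. bounded (?q ` {(t, s) \<in> ball a r \<times> ball b r. t \<noteq> s})"
  proof (cases "a = b")
    case True
    obtain d L where d: "d > 0"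
      and L: "\<And>t s. t \<in> ball a d \<Longrightarrow> s \<in> ball a d \<Longrightarrow> \<bar>f t - f s\<bar> \<le> L * \<bar>t - s\<bar> powr \<alpha>"
      using loc[of a] by blast
    have "norm (?q (t, s)) \<le> L" if "t \<in> ball a d" "s \<in> ball a d" "t \<noteq> s" for t s
    proof -
      have "norm (?q (t, s)) = \<bar>f t - f s\<bar> / \<bar>t - s\<bar> powr \<alpha>"
        by (simp add: divide_inverse abs_mult mult.commute)
      then show ?thesis
        using L[OF that(1,2)] that(3) by (simp add: pos_divide_le_eq)
    qed
    then show ?thesis
      using d True by (intro exI[of _ d] conjI boundedI[of _ L]) auto
  next
    case False
    \<comment> \<open>With a third of the distance even the closed balls around \<open>a\<close> and
      \<open>b\<close> are disjoint, so the denominator does not vanish on their product.\<close>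
    define r where "r = dist a b / 3"
    have r: "r > 0"
      using False by (simp add: r_def)
    have ne: "t \<noteq> s" if "t \<in> cball a r" "s \<in> cball b r" for t s
    proof
      assume "t = s"
      then have "dist a b \<le> dist a t + dist b s"
        by (metis dist_commute dist_triangle)
      then show False
        using that r unfolding r_def mem_cball by linarith
    qed
    have cont': "continuous_on X (\<lambda>x. f (g x))" if "continuous_on X g"
      for X :: "(real \<times> real) set" and g
      by (rule continuous_on_compose2[OF cont that]) simp
    have "continuous_on (cball a r \<times> cball b r) ?q"
      unfolding case_prod_beta using ne
      by (intro continuous_intros cont') auto
    then have "bounded (?q ` (cball a r \<times> cball b r))"
      by (intro compact_imp_bounded compact_continuous_image compact_Times compact_cball)
    then have "bounded (?q ` {(t, s) \<in> ball a r \<times> ball b r. t \<noteq> s})"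
      by (rule bounded_subset) (auto intro!: image_mono)
    then show ?thesis
      using r by blast
  qed
  then obtain r where r: "r > 0" "bounded (?q ` {(t, s) \<in> ball a r \<times> ball b r. t \<noteq> s})"
    by blast
  show "\<exists>N. open N \<and> p \<in> N \<and> bounded (?q ` {(t, s) \<in> N. t \<noteq> s})"
    using r p by (intro exI[of _ "ball a r \<times> ball b r"] conjI open_Times) auto
qed

section \<open>Reduction to smooth curves\<close>

theorem mainTheorem1:
  fixes U :: "'e::convenient_vector_space set"
    and \<alpha> :: real
    and A :: "'e \<Rightarrow> ('h::complex_hilbert_space \<rightharpoonup> 'h)"
    and lam :: "'e \<Rightarrow> real"
  assumes "openin cinf_topology U"
    and "0 < \<alpha>" and "\<alpha> \<le> 1"
    and "C0alpha_self_adjoint_on \<alpha> U A"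
    and "\<And>u. u \<in> U \<Longrightarrow> compact_resolvent (A u)"
    and "continuous_map (subtopology cinf_topology U) euclideanreal lam"
    and "\<And>u. u \<in> U \<Longrightarrow> eigenvalue (A u) (complex_of_real (lam u))"
  shows "C0alpha_on \<alpha> U lam"
  unfolding C0alpha_on_def
proof (intro allI impI, elim conjE)
  fix c :: "real \<Rightarrow> 'e"
  assume c: "smooth_curve c" and "range c \<subseteq> U"
  then have cU: "c t \<in> U" for t
    by blast
  obtain V where V: "\<forall>u\<in>U. dom (A u) = V \<and> self_adjoint (A u)"
    and hold: "\<forall>v\<in>V. \<forall>w. C0alpha_on \<alpha> U (\<lambda>u. cinner (the (A u v)) w)"
    using assms(4) unfolding C0alpha_self_adjoint_on_def by (elim exE conjE)
  \<comment> \<open>A relatively open set is the trace on \<open>U\<close> of some \<open>Z\<close>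
    open in \<open>cinf_topology\<close>, whose preimage under a smooth curve is open by
    definition.\<close>
  have "open ((lam \<circ> c) -` W)" if "open W" for W
  proof -
    have "openin (subtopology cinf_topology U) {u \<in> topspace (subtopology cinf_topology U). lam u \<in> W}"
      using assms(6) that by (auto simp: continuous_map_def)
    then obtain Z where Z: "openin cinf_topology Z"
      "{u \<in> topspace (subtopology cinf_topology U). lam u \<in> W} = Z \<inter> U"
      by (auto simp: openin_subtopology)
    have "topspace (subtopology cinf_topology U) = U"
      using openin_subset[OF assms(1)] by auto
    then have "(lam \<circ> c) -` W = c -` Z"
      using Z(2) cU by auto
    then show ?thesis
      using Z(1) c by (simp add: openin_cinf_topology)
  qed
  then have cont: "continuous_on UNIV (lam \<circ> c)"
    by (simp add: continuous_on_open_vimage o_def)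
  show "C0alpha \<alpha> (lam \<circ> c)"
  proof (rule C0alpha_if_local_Hoelder[OF cont])
    fix t0
    show "\<exists>d>0. \<exists>L. \<forall>t\<in>ball t0 d. \<forall>s\<in>ball t0 d.
        \<bar>(lam \<circ> c) t - (lam \<circ> c) s\<bar> \<le> L * \<bar>t - s\<bar> powr \<alpha>"
    proof (rule continuous_eigenvalue_local_Hoelder[of "A \<circ> c" V])
      fix v w assume "v \<in> V"
      then show "C0alpha \<alpha> (\<lambda>t. cinner (the ((A \<circ> c) t v)) w)"
        using hold c \<open>range c \<subseteq> U\<close> by (simp add: C0alpha_on_def o_def)
    qed (use V cU assms cont in auto)
  qed
qed

end
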